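(* Let $G$ be a locally compact abelian Polish group and let $S\subseteq G$ be a meager set. Then there is a meager set $T\subseteq G$ such that for all $s_1,s_2\in G$ there is a $t\in G$ with $(S+s_1)\cup(S+s_2)\subseteq T+t$.
   Context: Groups are written additively; for $A\subseteq G$ and $g\in G$, $A+g=\{a+g : a\in A\}$. *)

theory Defs
  imports "HOL-Analysis.Analysis"
begin

text \<open>
  Being Polish is a property of the topology alone. The library's class \<open>polish_space\<close>
  instead fixes a particular complete metric as part of the structure.
\<close>

definition Polish_topology :: "'a topology \<Rightarrow> bool"
  where "Polish_topology X \<longleftrightarrow> separable_space X \<and> completely_metrizable_space X"

definition nowhere_dense :: "'a::topological_space set \<Rightarrow> bool"
  where "nowhere_dense A \<longleftrightarrow> interior (closure A) = {}"

definition meager :: "'a::topological_space set \<Rightarrow> bool"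
  where "meager A \<longleftrightarrow> (\<exists>N :: nat \<Rightarrow> 'a set. (\<forall>n. nowhere_dense (N n)) \<and> A = (\<Union>n. N n))"

end

theory Submission
  imports Defs
begin

text \<open>
  The set \<open>T\<close> is built as the complement of a limit superior of open sets \<open>W m = D m + interior (C (m+1))\<close>,
  where \<open>D m\<close> consists of the first \<open>m+1\<close> terms of a dense sequence and the \<open>C m\<close> are compact
  neighbourhoods of \<open>0\<close> shrinking very fast.  Every tail of the \<open>W m\<close> has a dense open union, since it
  contains the whole dense sequence, so \<open>T\<close> is meager however fast the \<open>C m\<close> shrink.

  Let \<open>F m\<close> be increasing closed nowhere dense sets covering \<open>S\<close>.  To get
  \<open>(S + s1) \<union> (S + s2) \<subseteq> T + t\<close> it is enough that \<open>W m + t\<close> misses \<open>F m + s1\<close> and \<open>F m + s2\<close> for all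
  large \<open>m\<close>.  The element \<open>t\<close> is a limit of partial sums \<open>\<tau> m\<close> of small elements \<open>u m\<close>.  At stage \<open>m\<close>,
  a translate of the finite set \<open>D m\<close> has to avoid two translates of \<open>F m\<close>, and an arbitrarily
  small correction \<open>u m\<close> achieves this because \<open>F m\<close> is closed and nowhere dense.  Avoidance
  survives small perturbations, so the later corrections do no harm if \<open>C (m+1)\<close> is small enough.

  The difficulty is that \<open>T\<close>, and so \<open>C (m+1)\<close>, has to be fixed before \<open>s1\<close> and \<open>s2\<close> are known.  This is
  where local compactness enters: as long as \<open>s1 - \<tau> m\<close> and \<open>s2 - \<tau> m\<close> range over a compact
  set, one neighbourhood works for all of them (\<open>uniform_escape\<close>).  The compact sets used grow with
  \<open>m\<close> and absorb any given pair eventually; finitely many bad stages are harmless.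
  Local compactness also yields the limit \<open>t\<close>, as a common point of the
  nested compact sets \<open>\<tau> m + C m\<close>.
\<close>

section \<open>Translations and neighbourhoods of zero\<close>

lemma open_zero_halve:
  fixes W :: "'a::topological_ab_group_add set"
  assumes "open W" "0 \<in> W"
  obtains P where "open P" "0 \<in> P" "\<And>x y. x \<in> P \<Longrightarrow> y \<in> P \<Longrightarrow> x + y \<in> W"
proof -
  have "open ((\<lambda>z::'a \<times> 'a. fst z + snd z) -` W)"
    using assms(1) by (intro open_vimage continuous_intros)
  moreover have "(0, 0) \<in> (\<lambda>z::'a \<times> 'a. fst z + snd z) -` W"
    using assms(2) by simp
  ultimately obtain A B where AB: "open A" "open B" "(0, 0) \<in> A \<times> B"
      "A \<times> B \<subseteq> (\<lambda>z::'a \<times> 'a. fst z + snd z) -` W"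
    by (rule open_prod_elim)
  show thesis
    by (rule that[of "A \<inter> B"]) (use AB in \<open>auto simp: subset_iff\<close>)
qed

lemma compact_closed_zero_neighbourhood:
  fixes W :: "'a::topological_ab_group_add set"
  assumes "locally_compact_space (euclidean :: 'a topology)" "Hausdorff_space (euclidean :: 'a topology)"
    and "open W" "0 \<in> W"
  obtains C where "compact C" "closed C" "0 \<in> interior C" "C \<subseteq> W"
proof -
  have "neighbourhood_base_of (\<lambda>C. compactin euclidean C \<and> closedin euclidean C) (euclidean :: 'a topology)"
    using assms(1,2) locally_compact_Hausdorff_imp_regular_space
      locally_compact_regular_space_neighbourhood_base by blast
  then obtain U C where "open U" "compact C" "closed C" "0 \<in> U" "U \<subseteq> C" "C \<subseteq> W"
    unfolding neighbourhood_base_of using assms(3,4) by (auto 0 4)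
  then show thesis
    using that[of C] by (meson interiorI)
qed

text \<open>
  The admissible \<open>u\<close> form an open dense set for each \<open>r\<close>; the shifts are handled one at a time, each
  replacing \<open>P\<close> by a smaller nonempty open set.
\<close>

lemma translate_finitely_many_out:
  fixes F :: "'a::topological_ab_group_add set"
  assumes "finite R" "closed F" "interior F = {}" "open P" "P \<noteq> {}"
  shows "\<exists>u\<in>P. \<forall>r\<in>R. r + u \<notin> F"
  using assms(1,4,5)
proof (induction R arbitrary: P rule: finite_induct)
  case empty
  then show ?case by auto
next
  case (insert r R)
  let ?Q = "P \<inter> (\<lambda>u. r + u) -` (- F)"
  have "open ?Q"
    using insert.prems(1) assms(2) by (intro open_Int open_vimage continuous_intros) auto
  moreover have "?Q \<noteq> {}"
  proof
    assume "?Q = {}"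
    obtain x where "x \<in> P"
      using insert.prems(2) by auto
    have "open ((\<lambda>y. y - r) -` P)"
      using insert.prems(1) by (intro open_vimage continuous_intros)
    moreover have "(\<lambda>y. y - r) -` P \<subseteq> F"
    proof
      fix y assume "y \<in> (\<lambda>y. y - r) -` P"
      with \<open>?Q = {}\<close> have "r + (y - r) \<in> F"
        by blast
      then show "y \<in> F" by simp
    qed
    moreover have "r + x \<in> (\<lambda>y. y - r) -` P"
      using \<open>x \<in> P\<close> by simp
    ultimately show False
      using assms(3) interiorI by blast
  qed
  ultimately obtain u where "u \<in> ?Q" "\<forall>s\<in>R. s + u \<notin> F"
    using insert.IH by blast
  then show ?case by auto
qed

section \<open>Escaping a nowhere dense set uniformly\<close>

text \<open>
  For each single pair a suitable \<open>u\<close> exists, and it remains suitable for nearby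
  pairs and after a small error \<open>v\<close>. Covering \<open>L\<close> by finitely many of these neighbourhoods of pairs makes the
  allowed error independent of the pair.
\<close>

lemma uniform_escape:
  fixes F :: "'a::topological_ab_group_add set"
  assumes F: "closed F" "interior F = {}" and "finite D" and L: "compact L"
    and P: "open P" "0 \<in> P"
  obtains V where "open V" "0 \<in> V"
    "\<And>p q. (p, q) \<in> L \<Longrightarrow> \<exists>u\<in>P. \<forall>d\<in>D. \<forall>v\<in>V. d + u + v - p \<notin> F \<and> d + u + v - q \<notin> F"
proof -
  define G where "G u z \<longleftrightarrow> (\<forall>d\<in>D. d + u + snd z - fst (fst z) \<notin> F \<and> d + u + snd z - snd (fst z) \<notin> F)"
    for u and z :: "('a \<times> 'a) \<times> 'a"
  have openG: "open {z. G u z}" for u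
  proof -
    have "{z. G u z} = (\<Inter>d\<in>D. (\<lambda>z. d + u + snd z - fst (fst z)) -` (- F) \<inter>
        (\<lambda>z. d + u + snd z - snd (fst z)) -` (- F))"
      by (auto simp: G_def)
    also have "open \<dots>"
      using \<open>finite D\<close> F(1)
      by (intro open_INT ballI open_Int open_vimage continuous_intros) auto
    finally show ?thesis .
  qed
  define safe where "safe A B \<longleftrightarrow> (\<exists>u\<in>P. \<forall>y\<in>A. \<forall>v\<in>B. G u (y, v))" for A B
  have safe: "\<exists>A B. open A \<and> open B \<and> x \<in> A \<and> 0 \<in> B \<and> safe A B" for x
  proof -
    let ?R = "(\<lambda>d. d - fst x) ` D \<union> (\<lambda>d. d - snd x) ` D"
    obtain u where u: "u \<in> P" "\<forall>r\<in>?R. r + u \<notin> F"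
      using translate_finitely_many_out[of ?R F P] F P \<open>finite D\<close> by blast
    have "d - fst x + u \<notin> F \<and> d - snd x + u \<notin> F" if "d \<in> D" for d
      using u(2) that by blast
    then have "(x, 0) \<in> {z. G u z}"
      by (auto simp: G_def algebra_simps)
    then obtain A B where "open A" "open B" "(x, 0) \<in> A \<times> B" "A \<times> B \<subseteq> {z. G u z}"
      using open_prod_elim[OF openG] by metis
    moreover have "safe A B"
      unfolding safe_def using u(1) calculation(4) by (intro bexI[of _ u]) auto
    ultimately show ?thesis
      by (intro exI[of _ A] exI[of _ B]) simp
  qed
  have cover: "L \<subseteq> \<Union>{A. open A \<and> (\<exists>B. open B \<and> 0 \<in> B \<and> safe A B)}"
  proof
    fix x
    obtain A B where "open A" "open B" "x \<in> A" "0 \<in> B" "safe A B"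
      using safe[of x] by (elim exE conjE)
    then show "x \<in> \<Union>{A. open A \<and> (\<exists>B. open B \<and> 0 \<in> B \<and> safe A B)}"
      by (intro UnionI[of A]) auto
  qed
  obtain \<A> where \<A>: "\<A> \<subseteq> {A. open A \<and> (\<exists>B. open B \<and> 0 \<in> B \<and> safe A B)}"
      "finite \<A>" "L \<subseteq> \<Union>\<A>"
    by (rule compactE[OF L cover]) auto
  from \<A>(1) have "\<forall>A\<in>\<A>. \<exists>B. open B \<and> 0 \<in> B \<and> safe A B"
    by blast
  from bchoice[OF this] obtain B where B: "\<forall>A\<in>\<A>. open (B A) \<and> 0 \<in> B A \<and> safe A (B A)"
    by (rule exE)
  show thesis
  proof (rule that[of "\<Inter>A\<in>\<A>. B A"])
    show "open (\<Inter>A\<in>\<A>. B A)"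
      using \<A>(2) B by (intro open_INT) auto
    show "0 \<in> (\<Inter>A\<in>\<A>. B A)"
      using B by simp
    fix p q assume "(p, q) \<in> L"
    then obtain A where A: "A \<in> \<A>" "(p, q) \<in> A"
      using \<A>(3) by blast
    then have "safe A (B A)"
      using B by simp
    then obtain u where "u \<in> P" and u: "\<forall>y\<in>A. \<forall>v\<in>B A. G u (y, v)"
      unfolding safe_def by (rule bexE)
    have "d + u + v - p \<notin> F \<and> d + u + v - q \<notin> F" if "d \<in> D" "v \<in> (\<Inter>A\<in>\<A>. B A)" for d v
    proof -
      have "v \<in> B A"
        using that(2) A(1) by simp
      with u A(2) have "G u ((p, q), v)"
        by simp
      then show ?thesis
        using that(1) by (simp add: G_def)
    qed
    with \<open>u \<in> P\<close> show "\<exists>u\<in>P. \<forall>d\<in>D. \<forall>v\<in>\<Inter>A\<in>\<A>. B A. d + u + v - p \<notin> F \<and> d + u + v - q \<notin> F"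
      by (intro bexI[of _ u] ballI)
  qed
qed

text \<open>
  The requirement on a correction \<open>u\<close> between consecutive neighbourhoods \<open>C\<close>, \<open>C'\<close>. The first
  conjunct keeps the partial sums within nested sets; it is imposed also at the stages at which \<open>(p, q)\<close> is
  not yet in \<open>L\<close>, so that the sums make sense from the start. Of the two errors in the second conjunct,
  one accounts for the thickness of the open set \<open>W\<close> around \<open>D\<close>, the other for all later corrections.
\<close>

definition escapes ::
    "('a::ab_group_add \<times> 'a) set \<Rightarrow> 'a set \<Rightarrow> 'a set \<Rightarrow> 'a set \<Rightarrow> 'a set \<Rightarrow> 'a \<Rightarrow> 'a \<Rightarrow> 'a \<Rightarrow> bool"
  where "escapes L D F C C' p q u \<longleftrightarrow>
    (\<forall>c\<in>C'. u + c \<in> C) \<and>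
    ((p, q) \<in> L \<longrightarrow> (\<forall>d\<in>D. \<forall>v\<in>C'. \<forall>w\<in>C'. d + u + v + w - p \<notin> F \<and> d + u + v + w - q \<notin> F))"

lemma escapesI:
  assumes "\<And>c. c \<in> C' \<Longrightarrow> u + c \<in> C"
    and "\<And>d v w. (p, q) \<in> L \<Longrightarrow> d \<in> D \<Longrightarrow> v \<in> C' \<Longrightarrow> w \<in> C' \<Longrightarrow>
      d + u + v + w - p \<notin> F \<and> d + u + v + w - q \<notin> F"
  shows "escapes L D F C C' p q u"
  using assms by (simp add: escapes_def)

lemma escapesD:
  assumes "escapes L D F C C' p q u"
  shows "c \<in> C' \<Longrightarrow> u + c \<in> C"
    and "(p, q) \<in> L \<Longrightarrow> d \<in> D \<Longrightarrow> v \<in> C' \<Longrightarrow> w \<in> C' \<Longrightarrow> d + u + v + w - p \<notin> F \<and> d + u + v + w - q \<notin> F"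
  using assms by (simp_all add: escapes_def)

text \<open>
  \<open>C'\<close> is chosen inside half of \<open>C\<close>, to leave room for \<open>u\<close>, and inside half of the uniform
  neighbourhood, because it has to absorb two errors.
\<close>

lemma escaping_neighbourhood_exists:
  fixes F :: "'a::topological_ab_group_add set"
  assumes "locally_compact_space (euclidean :: 'a topology)" "Hausdorff_space (euclidean :: 'a topology)"
    and "closed F" "interior F = {}" "finite D" "compact L" "0 \<in> interior C"
  obtains C' where "compact C'" "closed C'" "0 \<in> interior C'" "\<And>p q. \<exists>u. escapes L D F C C' p q u"
proof -
  obtain P where P: "open P" "0 \<in> P" "\<And>x y. x \<in> P \<Longrightarrow> y \<in> P \<Longrightarrow> x + y \<in> interior C"
    using open_zero_halve[OF open_interior assms(7)] by blast
  obtain V where V: "open V" "0 \<in> V"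
    "\<And>p q. (p, q) \<in> L \<Longrightarrow> \<exists>u\<in>P. \<forall>d\<in>D. \<forall>v\<in>V. d + u + v - p \<notin> F \<and> d + u + v - q \<notin> F"
    using uniform_escape[OF assms(3-6) P(1,2)] by metis
  obtain H where H: "open H" "0 \<in> H" "\<And>x y. x \<in> H \<Longrightarrow> y \<in> H \<Longrightarrow> x + y \<in> V"
    using open_zero_halve[OF V(1,2)] by blast
  obtain C' where C': "compact C'" "closed C'" "0 \<in> interior C'" "C' \<subseteq> P \<inter> H"
    using compact_closed_zero_neighbourhood[OF assms(1,2), of "P \<inter> H"] P(1,2) H(1,2) by blast
  have "\<exists>u. escapes L D F C C' p q u" for p q
  proof -
    obtain u where u: "u \<in> P"
      "(p, q) \<in> L \<longrightarrow> (\<forall>d\<in>D. \<forall>v\<in>V. d + u + v - p \<notin> F \<and> d + u + v - q \<notin> F)"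
      using V(3)[of p q] P(2) by (cases "(p, q) \<in> L") auto
    have "d + u + v + w - p \<notin> F \<and> d + u + v + w - q \<notin> F"
      if "(p, q) \<in> L" "d \<in> D" "v \<in> C'" "w \<in> C'" for d v w
    proof -
      have "v + w \<in> V"
        using that(3,4) C'(4) H(3) by blast
      with u(2) that(1,2) have "d + u + (v + w) - p \<notin> F \<and> d + u + (v + w) - q \<notin> F"
        by blast
      then show ?thesis
        by (simp add: add.assoc)
    qed
    moreover have "u + c \<in> C" if "c \<in> C'" for c
      using that C'(4) P(3) u(1) interior_subset by blast
    ultimately have "escapes L D F C C' p q u"
      by (intro escapesI)
    then show ?thesis
      by (rule exI)
  qed
  then show thesis
    by (rule that[OF C'(1-3)])
qed

section \<open>The limit of the corrections\<close>

text \<open>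
  The corrections are summed along the sequence \<open>C\<close>. Since \<open>\<tau> m + C m\<close> is a decreasing sequence of nonempty compact
  sets, the partial sums have a limit point that stays within \<open>C m\<close> of each \<open>\<tau> m\<close>.
\<close>

lemma corrections_have_limit:
  fixes C :: "nat \<Rightarrow> 'a::topological_ab_group_add set"
  assumes C: "\<And>m. compact (C m)" "\<And>m. closed (C m)" "\<And>m. 0 \<in> C m"
    and step: "\<And>m p q. \<exists>u. escapes (L m) (D m) (F m) (C m) (C (Suc m)) p q u"
  obtains \<tau> t where "\<And>m. \<tau> m \<in> C 0" "\<And>m. t - \<tau> m \<in> C m"
    "\<And>m d v w. (s1 - \<tau> m, s2 - \<tau> m) \<in> L m \<Longrightarrow> d \<in> D m \<Longrightarrow> v \<in> C (Suc m) \<Longrightarrow> w \<in> C (Suc m) \<Longrightarrow>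
      d + \<tau> (Suc m) + v + w - s1 \<notin> F m \<and> d + \<tau> (Suc m) + v + w - s2 \<notin> F m"
proof -
  define u where "u m p q = (SOME u. escapes (L m) (D m) (F m) (C m) (C (Suc m)) p q u)" for m p q
  have u: "escapes (L m) (D m) (F m) (C m) (C (Suc m)) p q (u m p q)" for m p q
    unfolding u_def using step by (rule someI_ex)
  define \<tau> where "\<tau> = rec_nat 0 (\<lambda>m x. x + u m (s1 - x) (s2 - x))"
  have \<tau>: "\<tau> 0 = 0" "\<And>m. \<tau> (Suc m) = \<tau> m + u m (s1 - \<tau> m) (s2 - \<tau> m)"
    by (simp_all add: \<tau>_def)
  define K where "K m = (\<lambda>x. x - \<tau> m) -` C m" for m
  have "K (Suc m) \<subseteq> K m" for m
  proof
    fix x assume "x \<in> K (Suc m)"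
    then show "x \<in> K m"
      using escapesD(1)[OF u, of "x - \<tau> (Suc m)" m "s1 - \<tau> m" "s2 - \<tau> m"]
      by (simp add: K_def \<tau>(2) algebra_simps)
  qed
  then have decr: "K n \<subseteq> K m" if "m \<le> n" for m n
    using that by (rule lift_Suc_antimono_le)
  have mem: "\<tau> m \<in> K m" for m
    using C(3) by (simp add: K_def)
  have closedK: "closed (K m)" for m
    unfolding K_def using C(2) by (intro closed_vimage continuous_intros)
  have "K 0 = C 0"
    by (simp add: K_def \<tau>(1))
  have "C 0 \<inter> (\<Inter>m\<in>UNIV. K m) \<noteq> {}"
  proof (rule compact_imp_fip_image[OF C(1) closedK])
    fix I :: "nat set" assume "finite I"
    then have "\<forall>i\<in>I. i \<le> Max (insert 0 I)"
      by simp
    then have "\<tau> (Max (insert 0 I)) \<in> K 0 \<inter> (\<Inter>i\<in>I. K i)"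
      using mem decr by blast
    then show "C 0 \<inter> (\<Inter>i\<in>I. K i) \<noteq> {}"
      using \<open>K 0 = C 0\<close> by blast
  qed
  then obtain t where t: "\<And>m. t \<in> K m"
    by blast
  show thesis
  proof (rule that)
    show "\<tau> m \<in> C 0" for m
      using mem decr[of 0 m] \<open>K 0 = C 0\<close> by blast
    show "t - \<tau> m \<in> C m" for m
      using t[of m] by (simp add: K_def)
    show "d + \<tau> (Suc m) + v + w - s1 \<notin> F m \<and> d + \<tau> (Suc m) + v + w - s2 \<notin> F m"
      if "(s1 - \<tau> m, s2 - \<tau> m) \<in> L m" "d \<in> D m" "v \<in> C (Suc m)" "w \<in> C (Suc m)" for m d v w
      using escapesD(2)[OF u that] by (simp add: \<tau>(2) algebra_simps)
  qed
qed

section \<open>The meager set and its translates\<close>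

lemma meager_subset_increasing_closed:
  fixes S :: "'a::topological_space set"
  assumes "meager S"
  obtains F :: "nat \<Rightarrow> 'a set" where "\<And>m. closed (F m)" "\<And>m. interior (F m) = {}" "mono F" "S \<subseteq> (\<Union>m. F m)"
proof -
  obtain N :: "nat \<Rightarrow> 'a set" where N: "\<And>n. interior (closure (N n)) = {}" "S = (\<Union>n. N n)"
    using assms by (auto simp: meager_def nowhere_dense_def)
  define F where "F m = (\<Union>i\<le>m. closure (N i))" for m
  show thesis
  proof (rule that[of F])
    show closedF: "closed (F m)" for m
      by (auto simp: F_def)
    show "interior (F m) = {}" for m
    proof (induction m)
      case 0
      then show ?case using N(1) by (simp add: F_def)
    next
      case (Suc m)
      have "F (Suc m) = F m \<union> closure (N (Suc m))"
        by (auto simp: F_def atMost_Suc)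
      with Suc N(1) closedF interior_closed_Un_empty_interior show ?case
        by metis
    qed
    show "mono F"
      by (force simp: F_def mono_def)
    show "S \<subseteq> (\<Union>m. F m)"
      using N(2) closure_subset by (fastforce simp: F_def)
  qed
qed

lemma dense_sequence:
  assumes "separable_space (euclidean :: 'a::topological_space topology)"
  obtains e :: "nat \<Rightarrow> 'a::topological_space" where "\<And>U. open U \<Longrightarrow> U \<noteq> {} \<Longrightarrow> \<exists>i. e i \<in> U"
proof -
  obtain E :: "'a set" where E: "countable E" "closure E = UNIV"
    using assms by (auto simp: separable_space_def)
  then have "E \<noteq> {}"
    by auto
  show thesis
  proof (rule that[of "from_nat_into E"])
    fix U :: "'a set" assume "open U" "U \<noteq> {}"
    then have "U \<inter> E \<noteq> {}"
      using E(2) open_Int_closure_eq_empty by blast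
    then show "\<exists>i. from_nat_into E i \<in> U"
      using from_nat_into_surj[OF E(1)] by blast
  qed
qed

text \<open>
  The second hypothesis says that the union of every tail of \<open>W\<close> is dense, so the set below is a countable union of
  closed sets with empty interior.
\<close>

lemma meager_compl_limsup:
  fixes W :: "nat \<Rightarrow> 'a::topological_space set"
  assumes "\<And>m. open (W m)" "\<And>U n. open U \<Longrightarrow> U \<noteq> {} \<Longrightarrow> \<exists>m\<ge>n. W m \<inter> U \<noteq> {}"
  shows "meager {x. \<exists>n. \<forall>m\<ge>n. x \<notin> W m}"
  unfolding meager_def nowhere_dense_def
proof (intro exI[of _ "\<lambda>n. - (\<Union>m\<in>{n..}. W m)"] conjI allI)
  fix n
  have "closed (- (\<Union>m\<in>{n..}. W m))"
    using assms(1) by auto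
  moreover have "interior (- (\<Union>m\<in>{n..}. W m)) = {}"
  proof (rule ccontr)
    assume "interior (- (\<Union>m\<in>{n..}. W m)) \<noteq> {}"
    then obtain m where "m \<ge> n" "W m \<inter> interior (- (\<Union>m\<in>{n..}. W m)) \<noteq> {}"
      using assms(2) open_interior by blast
    then show False
      using interior_subset by fastforce
  qed
  ultimately show "interior (closure (- (\<Union>m\<in>{n..}. W m))) = {}"
    by simp
qed auto

theorem theorem2p4:
  fixes S :: "'a::topological_ab_group_add set"
  assumes "locally_compact_space (euclidean :: 'a topology)"
    and "Polish_topology (euclidean :: 'a topology)"
    and "meager S"
  shows "\<exists>T::'a set. meager T \<and>
    (\<forall>s1 s2. \<exists>t. (\<lambda>a. a + s1) ` S \<union> (\<lambda>a. a + s2) ` S \<subseteq> (\<lambda>a. a + t) ` T)"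
proof -
  have haus: "Hausdorff_space (euclidean :: 'a topology)"
    and sep: "separable_space (euclidean :: 'a topology)"
    using assms(2) by (auto simp: Polish_topology_def metrizable_imp_Hausdorff_space
        completely_metrizable_imp_metrizable_space)
  obtain F :: "nat \<Rightarrow> 'a set" where F: "\<And>m. closed (F m)" "\<And>m. interior (F m) = {}"
      and "mono F" and SF: "S \<subseteq> (\<Union>m. F m)"
    using meager_subset_increasing_closed[OF assms(3)] by blast
  obtain e :: "nat \<Rightarrow> 'a" where e: "\<And>U. open U \<Longrightarrow> U \<noteq> {} \<Longrightarrow> \<exists>i. e i \<in> U"
    using dense_sequence[OF sep] by blast
  define D where "D m = e ` {..m}" for m
  obtain C0 :: "'a set" where C0: "compact C0" "closed C0" "0 \<in> interior C0"
    using compact_closed_zero_neighbourhood[OF assms(1) haus, of UNIV] by auto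
  \<comment> \<open>The partial sums will lie in \<open>C0\<close>, and every \<open>s\<close> lies in \<open>D m + C0\<close> for large \<open>m\<close>, so \<open>K m\<close> contains
      the differences \<open>s - \<tau> m\<close> for large \<open>m\<close>.\<close>
  define K where "K m = (\<lambda>z. fst z + fst (snd z) - snd (snd z)) ` (D m \<times> C0 \<times> C0)" for m
  have compactK: "compact (K m)" for m
    unfolding K_def D_def using C0(1)
    by (intro compact_continuous_image compact_Times continuous_intros)
      (simp_all add: finite_imp_compact)
  let ?P = "\<lambda>(n::nat) C. compact C \<and> closed C \<and> 0 \<in> interior C \<and> (n = 0 \<longrightarrow> C = C0)"
  have "\<exists>C. \<forall>m. ?P m (C m) \<and> (\<forall>p q. \<exists>u. escapes (K m \<times> K m) (D m) (F m) (C m) (C (Suc m)) p q u)"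
  proof (rule dependent_nat_choice)
    show "\<exists>C. ?P 0 C"
      using C0 by blast
    fix C m assume C: "?P m C"
    have "finite (D m)" "compact (K m \<times> K m)" "0 \<in> interior C"
      using C by (auto simp: D_def intro: compact_Times compactK)
    from escaping_neighbourhood_exists[OF assms(1) haus F(1)[of m] F(2)[of m] this]
    obtain C' where "compact C'" "closed C'" "0 \<in> interior C'"
        "\<forall>p q. \<exists>u. escapes (K m \<times> K m) (D m) (F m) C C' p q u"
      by metis
    then show "\<exists>C'. ?P (Suc m) C' \<and> (\<forall>p q. \<exists>u. escapes (K m \<times> K m) (D m) (F m) C C' p q u)"
      by blast
  qed
  then obtain C where C: "\<And>m. compact (C m)" "\<And>m. closed (C m)" "\<And>m. 0 \<in> interior (C m)" "C 0 = C0"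
      and step: "\<And>m p q. \<exists>u. escapes (K m \<times> K m) (D m) (F m) (C m) (C (Suc m)) p q u"
    by blast
  have zero: "0 \<in> C m" for m
    using C(3) interior_subset by blast
  define W where "W m = (\<Union>d\<in>D m. (\<lambda>x. x - d) -` interior (C (Suc m)))" for m
  define T where "T = {x. \<exists>n. \<forall>m\<ge>n. x \<notin> W m}"
  have "meager T"
    unfolding T_def
  proof (rule meager_compl_limsup)
    show "open (W m)" for m
      unfolding W_def by (intro open_UN ballI open_vimage continuous_intros) auto
    fix U :: "'a set" and n assume "open U" "U \<noteq> {}"
    then obtain i where "e i \<in> U"
      using e by blast
    moreover have "e i \<in> W (max n i)"
      unfolding W_def using C(3) by (auto simp: D_def intro!: bexI[of _ i])
    ultimately show "\<exists>m\<ge>n. W m \<inter> U \<noteq> {}"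
      by (intro exI[of _ "max n i"]) auto
  qed
  moreover have "\<exists>t. (\<lambda>a. a + s1) ` S \<union> (\<lambda>a. a + s2) ` S \<subseteq> (\<lambda>a. a + t) ` T" for s1 s2
  proof -
    obtain \<tau> t where \<tau>: "\<And>m. \<tau> m \<in> C 0" and t: "\<And>m. t - \<tau> m \<in> C m"
      and avoid: "\<And>m d v w. (s1 - \<tau> m, s2 - \<tau> m) \<in> K m \<times> K m \<Longrightarrow> d \<in> D m \<Longrightarrow>
        v \<in> C (Suc m) \<Longrightarrow> w \<in> C (Suc m) \<Longrightarrow>
        d + \<tau> (Suc m) + v + w - s1 \<notin> F m \<and> d + \<tau> (Suc m) + v + w - s2 \<notin> F m"
      by (rule corrections_have_limit[where C = C and L = "\<lambda>m. K m \<times> K m" and D = D and F = F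
            and ?s1.0 = s1 and ?s2.0 = s2, OF C(1,2) zero step])
        (assumption | rule that)+
    have eventually_K: "\<exists>i. \<forall>m\<ge>i. s - \<tau> m \<in> K m" for s
    proof -
      have "open ((\<lambda>x. s - x) -` interior C0)"
        by (intro open_vimage continuous_intros) auto
      moreover have "s \<in> (\<lambda>x. s - x) -` interior C0"
        using C0(3) by simp
      ultimately obtain i where "e i \<in> (\<lambda>x. s - x) -` interior C0"
        using e by blast
      then have i: "s - e i \<in> C0"
        using interior_subset by blast
      have "s - \<tau> m \<in> K m" if "m \<ge> i" for m
        unfolding K_def
        by (rule image_eqI[of _ _ "(e i, s - e i, \<tau> m)"]) (use that i \<tau> C(4) in \<open>auto simp: D_def\<close>)
      then show ?thesis
        by blast
    qed
    obtain i1 i2 where i: "\<And>m. m \<ge> i1 \<Longrightarrow> s1 - \<tau> m \<in> K m" "\<And>m. m \<ge> i2 \<Longrightarrow> s2 - \<tau> m \<in> K m"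
      using eventually_K by metis
    have in_T: "a + s - t \<in> T" if "a \<in> S" "s = s1 \<or> s = s2" for a s
    proof -
      obtain n where "a \<in> F n"
        using SF \<open>a \<in> S\<close> by blast
      have "a + s - t \<notin> W m" if m: "m \<ge> max n (max i1 i2)" for m
      proof
        assume "a + s - t \<in> W m"
        then obtain d where d: "d \<in> D m" "a + s - t - d \<in> C (Suc m)"
          unfolding W_def using interior_subset by blast
        have "a \<in> F m"
          using \<open>a \<in> F n\<close> \<open>mono F\<close> m by (auto simp: mono_def)
        \<comment> \<open>The two errors: the tail of the corrections, and the position inside \<open>W m\<close>.\<close>
        moreover have "d + \<tau> (Suc m) + (t - \<tau> (Suc m)) + (a + s - t - d) - s = a"
          by (simp add: algebra_simps)
        moreover have "(s1 - \<tau> m, s2 - \<tau> m) \<in> K m \<times> K m"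
          using i m by auto
        ultimately show False
          using avoid[OF _ d(1) t d(2)] \<open>s = s1 \<or> s = s2\<close> by metis
      qed
      then show ?thesis
        unfolding T_def by blast
    qed
    show ?thesis
    proof (intro exI[of _ t] subsetI)
      fix x assume "x \<in> (\<lambda>a. a + s1) ` S \<union> (\<lambda>a. a + s2) ` S"
      then have "x - t \<in> T"
        using in_T by auto
      then show "x \<in> (\<lambda>a. a + t) ` T"
        by (intro image_eqI[of _ _ "x - t"]) auto
    qed
  qed
  ultimately show ?thesis
    by blast
qed

end
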